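(* Let $k$ be a field and let $(\mathcal C,\otimes,I,C)$ be a braided tensor category with a forgetful functor $F$ from $\mathcal C$ to the category of $k$-vector spaces such that $F(U\otimes V)=F(U)\otimes F(V)$ and $F(I)=k$. Let $H$ be a braided Hopf algebra in $\mathcal C$. If $H$ is semisimple with respect to $\mathcal C$ and $\ker\epsilon\in\mathcal C$, then $\epsilon(\int^l_H)\neq0$.
   Context: A braided Hopf algebra in $\mathcal C$ is a Hopf algebra object $(H,m,\eta,\Delta,\epsilon,S)$ in $\mathcal C$ (with $\Delta$ multiplicative for the braided tensor product algebra structure on $H\otimes H$). Objects are identified with their underlying $k$-vector spaces; $\ker\epsilon\in\mathcal C$ means that the kernel of the counit is (a subobject of $H$) in $\mathcal C$. $\int^l_H=\{x\in H\mid hx=\epsilon(h)x\text{ for all }h\in H\}$. An algebra $H$ in $\mathcal C$ is semisimple with respect to $\mathcal C$ if for every $H$-module $M$ in $\mathcal C$ and every $H$-submodule $N$ of $M$ in $\mathcal C$ there is an $H$-submodule $L$ of $M$ in $\mathcal C$ with $M=N\oplus L$. *)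

theory Defs
  imports "HOL-Algebra.AbelCoset" "HOL-Algebra.Module"
begin

section \<open>Categories, monoidal categories, braidings\<close>

record ('o, 'm) category =
  Obj :: "'o set"
  Arr :: "'m set"
  dom :: "'m \<Rightarrow> 'o"
  cod :: "'m \<Rightarrow> 'o"
  ident :: "'o \<Rightarrow> 'm"
  comp :: "'m \<Rightarrow> 'm \<Rightarrow> 'm" (infixl \<open>\<bullet>\<index>\<close> 55)

definition Hom :: "('o, 'm, 'x) category_scheme \<Rightarrow> 'o \<Rightarrow> 'o \<Rightarrow> 'm set" where
  "Hom C A B = {f \<in> Arr C. dom C f = A \<and> cod C f = B}"

locale category =
  fixes C (structure)
  assumes arr_endpoints: "f \<in> Arr C \<Longrightarrow> dom C f \<in> Obj C \<and> cod C f \<in> Obj C"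
    and ident_hom: "A \<in> Obj C \<Longrightarrow> ident C A \<in> Hom C A A"
    and comp_hom: "\<lbrakk>f \<in> Hom C A B; g \<in> Hom C B D\<rbrakk> \<Longrightarrow> g \<bullet> f \<in> Hom C A D"
    and comp_ident_right: "f \<in> Hom C A B \<Longrightarrow> f \<bullet> ident C A = f"
    and comp_ident_left: "f \<in> Hom C A B \<Longrightarrow> ident C B \<bullet> f = f"
    and comp_assoc: "\<lbrakk>f \<in> Hom C A B; g \<in> Hom C B D; h \<in> Hom C D E\<rbrakk>
      \<Longrightarrow> (h \<bullet> g) \<bullet> f = h \<bullet> (g \<bullet> f)"

definition inverse_arrows :: "('o, 'm, 'x) category_scheme \<Rightarrow> 'm \<Rightarrow> 'm \<Rightarrow> bool" where
  "inverse_arrows C f g \<longleftrightarrow>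
    f \<in> Arr C \<and> g \<in> Hom C (cod C f) (dom C f) \<and>
    comp C g f = ident C (dom C f) \<and> comp C f g = ident C (cod C f)"

definition isos :: "('o, 'm, 'x) category_scheme \<Rightarrow> 'o \<Rightarrow> 'o \<Rightarrow> 'm set" where
  "isos C A B = {f \<in> Hom C A B. \<exists>g. inverse_arrows C f g}"

definition inv_arr :: "('o, 'm, 'x) category_scheme \<Rightarrow> 'm \<Rightarrow> 'm" where
  "inv_arr C f = (THE g. inverse_arrows C f g)"

definition mono_arr :: "('o, 'm, 'x) category_scheme \<Rightarrow> 'm \<Rightarrow> bool" where
  "mono_arr C f \<longleftrightarrow> f \<in> Arr C \<and>
    (\<forall>X \<in> Obj C. \<forall>g \<in> Hom C X (dom C f). \<forall>h \<in> Hom C X (dom C f).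
      comp C f g = comp C f h \<longrightarrow> g = h)"

record ('o, 'm) monoidal_category = "('o, 'm) category" +
  tobj :: "'o \<Rightarrow> 'o \<Rightarrow> 'o" (infixr \<open>\<boxtimes>\<index>\<close> 70)
  tarr :: "'m \<Rightarrow> 'm \<Rightarrow> 'm" (infixr \<open>\<star>\<index>\<close> 70)
  unitobj :: "'o"
  assoc :: "'o \<Rightarrow> 'o \<Rightarrow> 'o \<Rightarrow> 'm"
  lunit :: "'o \<Rightarrow> 'm"
  runit :: "'o \<Rightarrow> 'm"

locale monoidal_category = category C for C (structure) +
  assumes tobj_closed: "\<lbrakk>A \<in> Obj C; B \<in> Obj C\<rbrakk> \<Longrightarrow> A \<boxtimes> B \<in> Obj C"
    and unit_closed: "unitobj C \<in> Obj C"
    and tarr_hom: "\<lbrakk>f \<in> Hom C A A'; g \<in> Hom C B B'\<rbrakk> \<Longrightarrow> f \<star> g \<in> Hom C (A \<boxtimes> B) (A' \<boxtimes> B')"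
    and tarr_ident: "\<lbrakk>A \<in> Obj C; B \<in> Obj C\<rbrakk> \<Longrightarrow> ident C A \<star> ident C B = ident C (A \<boxtimes> B)"
    and tarr_comp: "\<lbrakk>f \<in> Hom C A A'; f' \<in> Hom C A' A''; g \<in> Hom C B B'; g' \<in> Hom C B' B''\<rbrakk>
      \<Longrightarrow> (f' \<bullet> f) \<star> (g' \<bullet> g) = (f' \<star> g') \<bullet> (f \<star> g)"
    and assoc_iso: "\<lbrakk>U \<in> Obj C; V \<in> Obj C; W \<in> Obj C\<rbrakk>
      \<Longrightarrow> assoc C U V W \<in> isos C ((U \<boxtimes> V) \<boxtimes> W) (U \<boxtimes> (V \<boxtimes> W))"
    and lunit_iso: "U \<in> Obj C \<Longrightarrow> lunit C U \<in> isos C (unitobj C \<boxtimes> U) U"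
    and runit_iso: "U \<in> Obj C \<Longrightarrow> runit C U \<in> isos C (U \<boxtimes> unitobj C) U"
    and assoc_natural: "\<lbrakk>f \<in> Hom C U U'; g \<in> Hom C V V'; h \<in> Hom C W W'\<rbrakk>
      \<Longrightarrow> assoc C U' V' W' \<bullet> ((f \<star> g) \<star> h) = (f \<star> (g \<star> h)) \<bullet> assoc C U V W"
    and lunit_natural: "f \<in> Hom C U V
      \<Longrightarrow> lunit C V \<bullet> (ident C (unitobj C) \<star> f) = f \<bullet> lunit C U"
    and runit_natural: "f \<in> Hom C U V
      \<Longrightarrow> runit C V \<bullet> (f \<star> ident C (unitobj C)) = f \<bullet> runit C U"
    and pentagon: "\<lbrakk>U \<in> Obj C; V \<in> Obj C; W \<in> Obj C; X \<in> Obj C\<rbrakk>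
      \<Longrightarrow> assoc C U V (W \<boxtimes> X) \<bullet> assoc C (U \<boxtimes> V) W X
        = (ident C U \<star> assoc C V W X) \<bullet> (assoc C U (V \<boxtimes> W) X \<bullet> (assoc C U V W \<star> ident C X))"
    and triangle: "\<lbrakk>U \<in> Obj C; V \<in> Obj C\<rbrakk>
      \<Longrightarrow> (ident C U \<star> lunit C V) \<bullet> assoc C U (unitobj C) V = runit C U \<star> ident C V"

record ('o, 'm) braided_category = "('o, 'm) monoidal_category" +
  braid :: "'o \<Rightarrow> 'o \<Rightarrow> 'm"

locale braided_tensor_category = monoidal_category C for C (structure) +
  assumes braid_iso: "\<lbrakk>U \<in> Obj C; V \<in> Obj C\<rbrakk> \<Longrightarrow> braid C U V \<in> isos C (U \<boxtimes> V) (V \<boxtimes> U)"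
    and braid_natural: "\<lbrakk>f \<in> Hom C U U'; g \<in> Hom C V V'\<rbrakk>
      \<Longrightarrow> braid C U' V' \<bullet> (f \<star> g) = (g \<star> f) \<bullet> braid C U V"
    and hexagon: "\<lbrakk>U \<in> Obj C; V \<in> Obj C; W \<in> Obj C\<rbrakk>
      \<Longrightarrow> assoc C V W U \<bullet> (braid C U (V \<boxtimes> W) \<bullet> assoc C U V W)
        = (ident C V \<star> braid C U W) \<bullet> (assoc C V U W \<bullet> (braid C U V \<star> ident C W))"
    and hexagon': "\<lbrakk>U \<in> Obj C; V \<in> Obj C; W \<in> Obj C\<rbrakk>
      \<Longrightarrow> inv_arr C (assoc C W U V) \<bullet> (braid C (U \<boxtimes> V) W \<bullet> inv_arr C (assoc C U V W))
        = (braid C U W \<star> ident C V) \<bullet> (inv_arr C (assoc C U W V) \<bullet> (ident C U \<star> braid C V W))"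


section \<open>The tensor category of vector spaces\<close>

text \<open>Linear maps are extensional functions, so that they form honest hom-sets: two linear maps
  are equal as soon as they agree on the carrier.\<close>

definition linear_maps ::
  "('k, 'r) ring_scheme \<Rightarrow> ('k, 'u, 'p) module_scheme \<Rightarrow> ('k, 'v, 'q) module_scheme
    \<Rightarrow> ('u \<Rightarrow> 'v) set" where
  "linear_maps k U V = {f \<in> carrier U \<rightarrow>\<^sub>E carrier V.
     (\<forall>x \<in> carrier U. \<forall>y \<in> carrier U. f (x \<oplus>\<^bsub>U\<^esub> y) = f x \<oplus>\<^bsub>V\<^esub> f y) \<and>
     (\<forall>c \<in> carrier k. \<forall>x \<in> carrier U. f (c \<odot>\<^bsub>U\<^esub> x) = c \<odot>\<^bsub>V\<^esub> f x)}"

definition bilinear_map ::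
  "('k, 'r) ring_scheme \<Rightarrow> ('k, 'u, 'p) module_scheme \<Rightarrow> ('k, 'v, 'q) module_scheme
    \<Rightarrow> ('k, 'w, 's) module_scheme \<Rightarrow> ('u \<Rightarrow> 'v \<Rightarrow> 'w) \<Rightarrow> bool" where
  "bilinear_map k U V W b \<longleftrightarrow>
     (\<forall>u \<in> carrier U. (\<lambda>v \<in> carrier V. b u v) \<in> linear_maps k V W) \<and>
     (\<forall>v \<in> carrier V. (\<lambda>u \<in> carrier U. b u v) \<in> linear_maps k U W)"

text \<open>The universal property of the tensor product. The test spaces \<open>X\<close> are those carried by
  subsets of the type of \<open>T\<close>. If one of them is a line (below, \<open>F I\<close> is), then this is no
  restriction: testing against maps to a line already shows that the canonical map from any
  tensor product of \<open>U\<close> and \<open>V\<close> to \<open>T\<close> is injective (existence) and surjective (uniqueness).\<close>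

definition is_tensor_product ::
  "('k, 'r) ring_scheme \<Rightarrow> ('k, 'u) module \<Rightarrow> ('k, 'v) module \<Rightarrow> ('k, 'w) module
    \<Rightarrow> ('u \<Rightarrow> 'v \<Rightarrow> 'w) \<Rightarrow> bool" where
  "is_tensor_product k U V T t \<longleftrightarrow> bilinear_map k U V T t \<and>
     (\<forall>X :: ('k, 'w) module. module k X \<longrightarrow>
       (\<forall>b. bilinear_map k U V X b \<longrightarrow>
         (\<exists>!f. f \<in> linear_maps k T X \<and>
           (\<forall>u \<in> carrier U. \<forall>v \<in> carrier V. f (t u v) = b u v))))"

definition self_module :: "('k, 'r) ring_scheme \<Rightarrow> ('k, 'k) module" where
  "self_module k = \<lparr>carrier = carrier k, mult = mult k, one = one k, zero = zero k, add = add k,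
     smult = mult k\<rparr>"

text \<open>A functor to vector spaces whose values all have carriers in one type \<open>'v\<close>. The
  identifications \<open>F(U \<otimes> V) = F(U) \<otimes> F(V)\<close> and \<open>F(I) = k\<close> are part of the data:
  \<open>ptensor F U V u v\<close> is the element \<open>u \<otimes> v\<close> of \<open>F(U \<otimes> V)\<close>, and \<open>scalar F c\<close> is the scalar
  \<open>c\<close> viewed in \<open>F(I)\<close>.\<close>

record ('o, 'm, 'k, 'v) vect_functor =
  Fobj :: "'o \<Rightarrow> ('k, 'v) module"
  Farr :: "'m \<Rightarrow> 'v \<Rightarrow> 'v"
  ptensor :: "'o \<Rightarrow> 'o \<Rightarrow> 'v \<Rightarrow> 'v \<Rightarrow> 'v"
  scalar :: "'k \<Rightarrow> 'v"

text \<open>The identifications are those of tensor categories: they hold for morphisms as well, and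
  the associativity and unit constraints of \<open>C\<close> lie over the usual ones of vector spaces. The
  braiding, by contrast, need not lie over the flip. Faithfulness of \<open>F\<close> is not required.\<close>

locale forgetful_functor = braided_tensor_category C + field k
  for C :: "('o, 'm, 'x) braided_category_scheme" (structure)
    and k :: "('k, 'r) ring_scheme" +
  fixes F :: "('o, 'm, 'k, 'v) vect_functor"
  assumes Fobj_vector_space: "U \<in> Obj C \<Longrightarrow> module k (Fobj F U)"
    and Farr_linear: "f \<in> Hom C U V \<Longrightarrow> Farr F f \<in> linear_maps k (Fobj F U) (Fobj F V)"
    and Farr_ident: "U \<in> Obj C \<Longrightarrow> Farr F (ident C U) = (\<lambda>x \<in> carrier (Fobj F U). x)"
    and Farr_comp: "\<lbrakk>f \<in> Hom C U V; g \<in> Hom C V W\<rbrakk>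
      \<Longrightarrow> Farr F (g \<bullet>\<^bsub>C\<^esub> f) = compose (carrier (Fobj F U)) (Farr F g) (Farr F f)"
    and ptensor: "\<lbrakk>U \<in> Obj C; V \<in> Obj C\<rbrakk>
      \<Longrightarrow> is_tensor_product k (Fobj F U) (Fobj F V) (Fobj F (U \<boxtimes>\<^bsub>C\<^esub> V)) (ptensor F U V)"
    and Farr_tarr: "\<lbrakk>f \<in> Hom C U U'; g \<in> Hom C V V';
        u \<in> carrier (Fobj F U); v \<in> carrier (Fobj F V)\<rbrakk>
      \<Longrightarrow> Farr F (f \<star>\<^bsub>C\<^esub> g) (ptensor F U V u v) = ptensor F U' V' (Farr F f u) (Farr F g v)"
    and scalar_linear: "scalar F \<in> linear_maps k (self_module k) (Fobj F (unitobj C))"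
    and scalar_bij: "bij_betw (scalar F) (carrier k) (carrier (Fobj F (unitobj C)))"
    and Farr_assoc: "\<lbrakk>U \<in> Obj C; V \<in> Obj C; W \<in> Obj C;
        u \<in> carrier (Fobj F U); v \<in> carrier (Fobj F V); w \<in> carrier (Fobj F W)\<rbrakk>
      \<Longrightarrow> Farr F (assoc C U V W) (ptensor F (U \<boxtimes>\<^bsub>C\<^esub> V) W (ptensor F U V u v) w)
        = ptensor F U (V \<boxtimes>\<^bsub>C\<^esub> W) u (ptensor F V W v w)"
    and Farr_lunit: "\<lbrakk>U \<in> Obj C; c \<in> carrier k; u \<in> carrier (Fobj F U)\<rbrakk>
      \<Longrightarrow> Farr F (lunit C U) (ptensor F (unitobj C) U (scalar F c) u) = c \<odot>\<^bsub>Fobj F U\<^esub> u"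
    and Farr_runit: "\<lbrakk>U \<in> Obj C; c \<in> carrier k; u \<in> carrier (Fobj F U)\<rbrakk>
      \<Longrightarrow> Farr F (runit C U) (ptensor F U (unitobj C) u (scalar F c)) = c \<odot>\<^bsub>Fobj F U\<^esub> u"


section \<open>Braided Hopf algebras\<close>

record ('o, 'm) hopf =
  hobj :: 'o
  hmult :: 'm
  hunit :: 'm
  hcomult :: 'm
  hcounit :: 'm
  hantipode :: 'm

text \<open>\<open>(U \<otimes> V) \<otimes> (W \<otimes> X) \<rightarrow> (U \<otimes> W) \<otimes> (V \<otimes> X)\<close>, braiding the two middle factors.\<close>

definition middle_braid ::
  "('o, 'm, 'x) braided_category_scheme \<Rightarrow> 'o \<Rightarrow> 'o \<Rightarrow> 'o \<Rightarrow> 'o \<Rightarrow> 'm" where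
  "middle_braid C U V W X =
     inv_arr C (assoc C U W (V \<boxtimes>\<^bsub>C\<^esub> X))
     \<bullet>\<^bsub>C\<^esub> (ident C U \<star>\<^bsub>C\<^esub> assoc C W V X)
     \<bullet>\<^bsub>C\<^esub> (ident C U \<star>\<^bsub>C\<^esub> (braid C V W \<star>\<^bsub>C\<^esub> ident C X))
     \<bullet>\<^bsub>C\<^esub> (ident C U \<star>\<^bsub>C\<^esub> inv_arr C (assoc C V W X))
     \<bullet>\<^bsub>C\<^esub> assoc C U V (W \<boxtimes>\<^bsub>C\<^esub> X)"

locale braided_hopf_algebra = braided_tensor_category C
  for C :: "('o, 'm, 'x) braided_category_scheme" (structure) +
  fixes H :: "('o, 'm) hopf"
  assumes hobj_closed: "hobj H \<in> Obj C"
    and hmult_hom: "hmult H \<in> Hom C (hobj H \<boxtimes> hobj H) (hobj H)"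
    and hunit_hom: "hunit H \<in> Hom C (unitobj C) (hobj H)"
    and hcomult_hom: "hcomult H \<in> Hom C (hobj H) (hobj H \<boxtimes> hobj H)"
    and hcounit_hom: "hcounit H \<in> Hom C (hobj H) (unitobj C)"
    and hantipode_hom: "hantipode H \<in> Hom C (hobj H) (hobj H)"
    and hmult_assoc: "hmult H \<bullet> (hmult H \<star> ident C (hobj H))
      = hmult H \<bullet> (ident C (hobj H) \<star> hmult H) \<bullet> assoc C (hobj H) (hobj H) (hobj H)"
    and hunit_left: "hmult H \<bullet> (hunit H \<star> ident C (hobj H)) = lunit C (hobj H)"
    and hunit_right: "hmult H \<bullet> (ident C (hobj H) \<star> hunit H) = runit C (hobj H)"
    and hcomult_coassoc: "assoc C (hobj H) (hobj H) (hobj H)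
        \<bullet> (hcomult H \<star> ident C (hobj H)) \<bullet> hcomult H
      = (ident C (hobj H) \<star> hcomult H) \<bullet> hcomult H"
    and hcounit_left:
      "lunit C (hobj H) \<bullet> (hcounit H \<star> ident C (hobj H)) \<bullet> hcomult H = ident C (hobj H)"
    and hcounit_right:
      "runit C (hobj H) \<bullet> (ident C (hobj H) \<star> hcounit H) \<bullet> hcomult H = ident C (hobj H)"
    and hcomult_mult: "hcomult H \<bullet> hmult H
      = (hmult H \<star> hmult H) \<bullet> middle_braid C (hobj H) (hobj H) (hobj H) (hobj H)
        \<bullet> (hcomult H \<star> hcomult H)"
    and hcomult_unit: "hcomult H \<bullet> hunit H
      = (hunit H \<star> hunit H) \<bullet> inv_arr C (lunit C (unitobj C))"
    and hcounit_mult: "hcounit H \<bullet> hmult H = lunit C (unitobj C) \<bullet> (hcounit H \<star> hcounit H)"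
    and hcounit_unit: "hcounit H \<bullet> hunit H = ident C (unitobj C)"
    and hantipode_left: "hmult H \<bullet> (hantipode H \<star> ident C (hobj H)) \<bullet> hcomult H
      = hunit H \<bullet> hcounit H"
    and hantipode_right: "hmult H \<bullet> (ident C (hobj H) \<star> hantipode H) \<bullet> hcomult H
      = hunit H \<bullet> hcounit H"


section \<open>Modules, semisimplicity, integrals\<close>

definition hmodule ::
  "('o, 'm, 'x) braided_category_scheme \<Rightarrow> ('o, 'm) hopf \<Rightarrow> 'o \<Rightarrow> 'm \<Rightarrow> bool" where
  "hmodule C H M a \<longleftrightarrow> M \<in> Obj C \<and> a \<in> Hom C (hobj H \<boxtimes>\<^bsub>C\<^esub> M) M \<and>
     a \<bullet>\<^bsub>C\<^esub> (hmult H \<star>\<^bsub>C\<^esub> ident C M)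
       = a \<bullet>\<^bsub>C\<^esub> (ident C (hobj H) \<star>\<^bsub>C\<^esub> a) \<bullet>\<^bsub>C\<^esub> assoc C (hobj H) (hobj H) M \<and>
     a \<bullet>\<^bsub>C\<^esub> (hunit H \<star>\<^bsub>C\<^esub> ident C M) = lunit C M"

text \<open>A subobject is a monomorphism whose underlying linear map is injective; the corresponding
  subspace of \<open>F(M)\<close> is its image.\<close>

definition subobject ::
  "('o, 'm, 'x) braided_category_scheme \<Rightarrow> ('o, 'm, 'k, 'v) vect_functor
    \<Rightarrow> 'o \<Rightarrow> 'o \<Rightarrow> 'm \<Rightarrow> bool" where
  "subobject C F M N i \<longleftrightarrow> N \<in> Obj C \<and> i \<in> Hom C N M \<and> mono_arr C i \<and>
     inj_on (Farr F i) (carrier (Fobj F N))"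

definition subspace_of :: "('o, 'm, 'k, 'v) vect_functor \<Rightarrow> 'o \<Rightarrow> 'm \<Rightarrow> 'v set" where
  "subspace_of F N i = Farr F i ` carrier (Fobj F N)"

definition hsubmodule ::
  "('o, 'm, 'x) braided_category_scheme \<Rightarrow> ('o, 'm, 'k, 'v) vect_functor \<Rightarrow> ('o, 'm) hopf
    \<Rightarrow> 'o \<Rightarrow> 'm \<Rightarrow> 'o \<Rightarrow> 'm \<Rightarrow> 'm \<Rightarrow> bool" where
  "hsubmodule C F H M a N b i \<longleftrightarrow> hmodule C H N b \<and> subobject C F M N i \<and>
     i \<bullet>\<^bsub>C\<^esub> b = a \<bullet>\<^bsub>C\<^esub> (ident C (hobj H) \<star>\<^bsub>C\<^esub> i)"

definition direct_sum :: "('k, 'v) module \<Rightarrow> 'v set \<Rightarrow> 'v set \<Rightarrow> bool" where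
  "direct_sum M A B \<longleftrightarrow> carrier M = A <+>\<^bsub>M\<^esub> B \<and> A \<inter> B = {\<zero>\<^bsub>M\<^esub>}"

text \<open>\<open>M = N \<oplus> L\<close> is the internal direct sum of underlying spaces; the projections onto \<open>N\<close> and
  \<open>L\<close> are not required to be morphisms of \<open>C\<close>.\<close>

definition semisimple_wrt ::
  "('o, 'm, 'x) braided_category_scheme \<Rightarrow> ('o, 'm, 'k, 'v) vect_functor \<Rightarrow> ('o, 'm) hopf
    \<Rightarrow> bool" where
  "semisimple_wrt C F H \<longleftrightarrow>
     (\<forall>M a. hmodule C H M a \<longrightarrow>
       (\<forall>N b i. hsubmodule C F H M a N b i \<longrightarrow>
         (\<exists>L c j. hsubmodule C F H M a L c j \<and>
           direct_sum (Fobj F M) (subspace_of F N i) (subspace_of F L j))))"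

text \<open>The linear kernel of the counit is the underlying space of a subobject of \<open>H\<close> that is the
  kernel of the counit in \<open>C\<close>. The factorization clause is what makes it the kernel in \<open>C\<close>:
  a \<open>C\<close>-structure on the subspace for which the inclusion is a morphism need not be unique, and
  need not be stable under morphisms of \<open>C\<close> with values in the subspace. As \<open>C\<close> need not have
  zero morphisms, vanishing is tested on underlying spaces.\<close>

definition counit_kernel_in ::
  "('o, 'm, 'x) braided_category_scheme \<Rightarrow> ('o, 'm, 'k, 'v) vect_functor \<Rightarrow> ('o, 'm) hopf
    \<Rightarrow> bool" where
  "counit_kernel_in C F H \<longleftrightarrow>
     (\<exists>K i. subobject C F (hobj H) K i \<and>
       subspace_of F K i
         = {x \<in> carrier (Fobj F (hobj H)). Farr F (hcounit H) x = \<zero>\<^bsub>Fobj F (unitobj C)\<^esub>} \<and>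
       (\<forall>X \<in> Obj C. \<forall>f \<in> Hom C X (hobj H).
         (\<forall>x \<in> carrier (Fobj F X). Farr F (hcounit H \<bullet>\<^bsub>C\<^esub> f) x = \<zero>\<^bsub>Fobj F (unitobj C)\<^esub>) \<longrightarrow>
         (\<exists>!g. g \<in> Hom C X K \<and> i \<bullet>\<^bsub>C\<^esub> g = f)))"

definition counit_val ::
  "('k, 'r) ring_scheme \<Rightarrow> ('o, 'm, 'k, 'v) vect_functor \<Rightarrow> ('o, 'm) hopf \<Rightarrow> 'v \<Rightarrow> 'k" where
  "counit_val k F H h = the_inv_into (carrier k) (scalar F) (Farr F (hcounit H) h)"

definition left_integrals ::
  "('k, 'r) ring_scheme \<Rightarrow> ('o, 'm, 'k, 'v) vect_functor \<Rightarrow> ('o, 'm) hopf \<Rightarrow> 'v set" where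
  "left_integrals k F H = {x \<in> carrier (Fobj F (hobj H)). \<forall>h \<in> carrier (Fobj F (hobj H)).
     Farr F (hmult H) (ptensor F (hobj H) (hobj H) h x)
       = counit_val k F H h \<odot>\<^bsub>Fobj F (hobj H)\<^esub> x}"

end

theory Submission
  imports Defs
begin

text \<open>The kernel of \<open>\<epsilon>\<close> is a left ideal, hence a submodule of the regular module \<open>H\<close>, and by
  semisimplicity it has a complement \<open>L\<close>. Write \<open>1 = x + y\<close> with \<open>\<epsilon>(x) = 0\<close> and \<open>y \<in> L\<close>. For every
  \<open>h\<close> the element \<open>h y - \<epsilon>(h) y\<close> lies in \<open>L\<close> and is annihilated by \<open>\<epsilon>\<close>, so it vanishes. Thus \<open>y\<close>
  is a left integral with \<open>\<epsilon>(y) = 1\<close>.\<close>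

section \<open>Linear maps and tensor products of vector spaces\<close>

lemma linear_maps_closed:
  "\<lbrakk>f \<in> linear_maps k U V; x \<in> carrier U\<rbrakk> \<Longrightarrow> f x \<in> carrier V"
  by (auto simp: linear_maps_def PiE_def)

lemma linear_maps_add:
  "\<lbrakk>f \<in> linear_maps k U V; x \<in> carrier U; y \<in> carrier U\<rbrakk>
    \<Longrightarrow> f (x \<oplus>\<^bsub>U\<^esub> y) = f x \<oplus>\<^bsub>V\<^esub> f y"
  by (simp add: linear_maps_def)

lemma linear_maps_smult:
  "\<lbrakk>f \<in> linear_maps k U V; c \<in> carrier k; x \<in> carrier U\<rbrakk>
    \<Longrightarrow> f (c \<odot>\<^bsub>U\<^esub> x) = c \<odot>\<^bsub>V\<^esub> f x"
  by (simp add: linear_maps_def)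

lemma linear_maps_minus:
  assumes "module k U" "module k V" "f \<in> linear_maps k U V" "x \<in> carrier U" "y \<in> carrier U"
  shows "f (x \<ominus>\<^bsub>U\<^esub> y) = f x \<ominus>\<^bsub>V\<^esub> f y"
proof -
  interpret U: module k U by fact
  interpret V: module k V by fact
  have "f (x \<ominus>\<^bsub>U\<^esub> y) \<oplus>\<^bsub>V\<^esub> f y = f ((x \<ominus>\<^bsub>U\<^esub> y) \<oplus>\<^bsub>U\<^esub> y)"
    using assms by (simp add: linear_maps_add)
  also have "(x \<ominus>\<^bsub>U\<^esub> y) \<oplus>\<^bsub>U\<^esub> y = x"
    using assms by (simp add: U.minus_eq U.M.a_assoc U.M.l_neg)
  finally have "f (x \<ominus>\<^bsub>U\<^esub> y) \<oplus>\<^bsub>V\<^esub> f y = f x" .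
  moreover have "(f x \<ominus>\<^bsub>V\<^esub> f y) \<oplus>\<^bsub>V\<^esub> f y = f x"
    using assms by (simp add: V.minus_eq V.M.a_assoc V.M.l_neg linear_maps_closed)
  ultimately have "f (x \<ominus>\<^bsub>U\<^esub> y) \<oplus>\<^bsub>V\<^esub> f y = (f x \<ominus>\<^bsub>V\<^esub> f y) \<oplus>\<^bsub>V\<^esub> f y"
    by simp
  moreover have "f x \<in> carrier V" "f y \<in> carrier V" "f (x \<ominus>\<^bsub>U\<^esub> y) \<in> carrier V"
    using assms(3-5) U.M.minus_closed by (blast intro: linear_maps_closed)+
  ultimately show ?thesis
    using V.M.add.right_cancel V.M.minus_closed by blast
qed

lemma zero_linear_map:
  assumes "module k U" "module k V"
  shows "(\<lambda>x \<in> carrier U. \<zero>\<^bsub>V\<^esub>) \<in> linear_maps k U V"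
proof -
  interpret U: module k U by fact
  interpret V: module k V by fact
  show ?thesis by (simp add: linear_maps_def)
qed

lemma tensor_product_closed:
  assumes "is_tensor_product k U V T t" "u \<in> carrier U" "v \<in> carrier V"
  shows "t u v \<in> carrier T"
proof -
  have "(\<lambda>v \<in> carrier V. t u v) \<in> linear_maps k V T"
    using assms by (simp add: is_tensor_product_def bilinear_map_def)
  from linear_maps_closed[OF this assms(3)] show ?thesis using assms(3) by simp
qed

text \<open>This is the uniqueness half of the universal property: \<open>f\<close> and the zero map
  both extend the zero bilinear map. It replaces an argument that pure tensors span.
  \<open>T\<close> and \<open>X\<close> share the element type \<open>'w\<close> because only such
  test spaces occur in \<open>is_tensor_product\<close>; the values of one functor \<open>F\<close>
  satisfy this.\<close>

lemma tensor_product_zero: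
  fixes T X :: "('k, 'w) module"
  assumes T: "is_tensor_product k U V T t" and "module k U" "module k V" "module k T" "module k X"
    and f: "f \<in> linear_maps k T X"
    and f0: "\<And>u v. \<lbrakk>u \<in> carrier U; v \<in> carrier V\<rbrakk> \<Longrightarrow> f (t u v) = \<zero>\<^bsub>X\<^esub>"
    and x: "x \<in> carrier T"
  shows "f x = \<zero>\<^bsub>X\<^esub>"
proof -
  have "bilinear_map k U V X (\<lambda>u v. \<zero>\<^bsub>X\<^esub>)"
    using assms by (simp add: bilinear_map_def zero_linear_map)
  with T \<open>module k X\<close> have
    "\<exists>!g. g \<in> linear_maps k T X \<and> (\<forall>u \<in> carrier U. \<forall>v \<in> carrier V. g (t u v) = \<zero>\<^bsub>X\<^esub>)"
    unfolding is_tensor_product_def by blast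
  moreover have "(\<lambda>x \<in> carrier T. \<zero>\<^bsub>X\<^esub>) \<in> linear_maps k T X"
    using assms by (simp add: zero_linear_map)
  moreover have "\<forall>u \<in> carrier U. \<forall>v \<in> carrier V. (\<lambda>x \<in> carrier T. \<zero>\<^bsub>X\<^esub>) (t u v) = \<zero>\<^bsub>X\<^esub>"
    using tensor_product_closed[OF T] by simp
  \<comment> \<open>The restriction of the zero function to \<open>carrier T\<close> is essential
    for this equality of functions: members of \<open>linear_maps\<close> are extensional.\<close>
  ultimately have "f = (\<lambda>x \<in> carrier T. \<zero>\<^bsub>X\<^esub>)"
    using f f0 by blast
  then show ?thesis using x by simp
qed

section \<open>Modules over \<open>H\<close> inside the category\<close>

lemma (in braided_hopf_algebra) regular_hmodule: "hmodule C H (hobj H) (hmult H)"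
  using hobj_closed hmult_hom hmult_assoc hunit_left by (simp add: hmodule_def)

text \<open>Each module axiom for \<open>b\<close> becomes, after composition with \<open>i\<close>,
  the corresponding axiom for \<open>a\<close>; since \<open>i\<close> is a monomorphism it can be
  cancelled. The argument is carried out with arrows because \<open>F\<close> may fail to be
  faithful, so identities in \<open>C\<close> cannot be checked on elements.\<close>

lemma (in braided_hopf_algebra) hmodule_of_mono:
  assumes M: "hmodule C H M a" and N: "N \<in> Obj C" and i: "i \<in> Hom C N M" and mono: "mono_arr C i"
    and b: "b \<in> Hom C (hobj H \<boxtimes> N) N" and ib: "i \<bullet> b = a \<bullet> (ident C (hobj H) \<star> i)"
  shows "hmodule C H N b"
proof -
  let ?H = "hobj H" and ?I = "unitobj C"
  let ?e = "ident C ?H" and ?n = "ident C N" and ?m = "ident C M"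
  from M have MO: "M \<in> Obj C" and a: "a \<in> Hom C (?H \<boxtimes> M) M"
    and aa: "a \<bullet> (hmult H \<star> ?m) = a \<bullet> (?e \<star> a) \<bullet> assoc C ?H ?H M"
    and au: "a \<bullet> (hunit H \<star> ?m) = lunit C M"
    by (auto simp: hmodule_def)
  note e = ident_hom[OF hobj_closed] and n = ident_hom[OF N] and m = ident_hom[OF MO]
  have HH: "?H \<boxtimes> ?H \<in> Obj C" by (simp add: tobj_closed hobj_closed)
  have cancel: "g = g'" if "g \<in> Hom C X N" "g' \<in> Hom C X N" "i \<bullet> g = i \<bullet> g'" "X \<in> Obj C" for g g' X
    using mono i that by (auto simp: mono_arr_def Hom_def)
  have as: "assoc C ?H ?H N \<in> Hom C ((?H \<boxtimes> ?H) \<boxtimes> N) (?H \<boxtimes> (?H \<boxtimes> N))"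
    and as': "assoc C ?H ?H M \<in> Hom C ((?H \<boxtimes> ?H) \<boxtimes> M) (?H \<boxtimes> (?H \<boxtimes> M))"
    using assoc_iso[OF hobj_closed hobj_closed] N MO by (auto simp: isos_def)
  have lu: "lunit C N \<in> Hom C (?I \<boxtimes> N) N"
    using lunit_iso[OF N] by (auto simp: isos_def)
  \<comment> \<open>By the interchange law both sides equal \<open>g \<star> i\<close>.\<close>
  have swap: "(?e \<star> i) \<bullet> (g \<star> ?n) = (g \<star> ?m) \<bullet> (ident C X \<star> i)"
    if g: "g \<in> Hom C X ?H" and X: "X \<in> Obj C" for g X
    using tarr_comp[OF g e n i] tarr_comp[OF ident_hom[OF X] g i m] i g
    by (simp add: comp_ident_left comp_ident_right)
  \<comment> \<open>Used twice below: \<open>g = hmult H\<close> gives associativity,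
    \<open>g = hunit H\<close> gives the unit law.\<close>
  have act: "i \<bullet> (b \<bullet> (g \<star> ?n)) = (a \<bullet> (g \<star> ?m)) \<bullet> (ident C X \<star> i)"
    if g: "g \<in> Hom C X ?H" and X: "X \<in> Obj C" for g X
  proof -
    have "i \<bullet> (b \<bullet> (g \<star> ?n)) = (a \<bullet> (?e \<star> i)) \<bullet> (g \<star> ?n)"
      using comp_assoc[OF tarr_hom[OF g n] b i] ib by simp
    also have "\<dots> = a \<bullet> ((g \<star> ?m) \<bullet> (ident C X \<star> i))"
      using comp_assoc[OF tarr_hom[OF g n] tarr_hom[OF e i] a] swap[OF g X] by simp
    also have "\<dots> = (a \<bullet> (g \<star> ?m)) \<bullet> (ident C X \<star> i)"
      using comp_assoc[OF tarr_hom[OF ident_hom[OF X] i] tarr_hom[OF g m] a] by simp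
    finally show ?thesis .
  qed
  have eb: "?e \<star> b \<in> Hom C (?H \<boxtimes> (?H \<boxtimes> N)) (?H \<boxtimes> N)" and ea: "?e \<star> a \<in> Hom C (?H \<boxtimes> (?H \<boxtimes> M)) (?H \<boxtimes> M)"
    and ei: "?e \<star> i \<in> Hom C (?H \<boxtimes> N) (?H \<boxtimes> M)"
    using tarr_hom e a b i by blast+
  have eei: "?e \<star> (?e \<star> i) \<in> Hom C (?H \<boxtimes> (?H \<boxtimes> N)) (?H \<boxtimes> (?H \<boxtimes> M))"
    using tarr_hom[OF e ei] .
  have iei: "ident C (?H \<boxtimes> ?H) \<star> i \<in> Hom C ((?H \<boxtimes> ?H) \<boxtimes> N) ((?H \<boxtimes> ?H) \<boxtimes> M)"
    using tarr_hom[OF ident_hom[OF HH] i] .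
  have "b \<bullet> (hmult H \<star> ?n) = b \<bullet> (?e \<star> b) \<bullet> assoc C ?H ?H N"
  proof (rule cancel)
    have "i \<bullet> (b \<bullet> (hmult H \<star> ?n)) = (a \<bullet> (?e \<star> a) \<bullet> assoc C ?H ?H M) \<bullet> (ident C (?H \<boxtimes> ?H) \<star> i)"
      using act[OF hmult_hom HH] aa by simp
    also have "\<dots> = (a \<bullet> (?e \<star> a)) \<bullet> (assoc C ?H ?H M \<bullet> (ident C (?H \<boxtimes> ?H) \<star> i))"
      by (rule comp_assoc[OF iei as' comp_hom[OF ea a]])
    \<comment> \<open>Naturality of the associator lets \<open>i\<close> pass to the innermost
      factor, next to the inner \<open>a\<close>, where \<open>ib\<close> can be applied.\<close>
    also have "\<dots> = (a \<bullet> (?e \<star> a)) \<bullet> ((?e \<star> (?e \<star> i)) \<bullet> assoc C ?H ?H N)"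
      using assoc_natural[OF e e i] by (simp add: tarr_ident hobj_closed)
    also have "\<dots> = ((a \<bullet> (?e \<star> a)) \<bullet> (?e \<star> (?e \<star> i))) \<bullet> assoc C ?H ?H N"
      using comp_assoc[OF as eei comp_hom[OF ea a]] by simp
    also have "(a \<bullet> (?e \<star> a)) \<bullet> (?e \<star> (?e \<star> i)) = a \<bullet> ((?e \<star> a) \<bullet> (?e \<star> (?e \<star> i)))"
      by (rule comp_assoc[OF eei ea a])
    \<comment> \<open>The inner action is replaced first, by \<open>ib\<close> under
      \<open>?e \<star> _\<close>; splitting off \<open>?e \<star> i\<close> afterwards prepares the
      same replacement for the outer action.\<close>
    also have "(?e \<star> a) \<bullet> (?e \<star> (?e \<star> i)) = ?e \<star> (i \<bullet> b)"
      using tarr_comp[OF e e ei a] e ib by (simp add: comp_ident_left)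
    also have "?e \<star> (i \<bullet> b) = (?e \<star> i) \<bullet> (?e \<star> b)"
      using tarr_comp[OF e e b i] e by (simp add: comp_ident_left)
    also have "a \<bullet> ((?e \<star> i) \<bullet> (?e \<star> b)) = (i \<bullet> b) \<bullet> (?e \<star> b)"
      using comp_assoc[OF eb ei a] ib by simp
    also have "\<dots> = i \<bullet> (b \<bullet> (?e \<star> b))"
      by (rule comp_assoc[OF eb b i])
    also have "\<dots> \<bullet> assoc C ?H ?H N = i \<bullet> (b \<bullet> (?e \<star> b) \<bullet> assoc C ?H ?H N)"
      by (rule comp_assoc[OF as comp_hom[OF eb b] i])
    finally show "i \<bullet> (b \<bullet> (hmult H \<star> ?n)) = i \<bullet> (b \<bullet> (?e \<star> b) \<bullet> assoc C ?H ?H N)" .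
    show "b \<bullet> (hmult H \<star> ?n) \<in> Hom C ((?H \<boxtimes> ?H) \<boxtimes> N) N"
      by (rule comp_hom[OF tarr_hom[OF hmult_hom n] b])
    show "b \<bullet> (?e \<star> b) \<bullet> assoc C ?H ?H N \<in> Hom C ((?H \<boxtimes> ?H) \<boxtimes> N) N"
      by (rule comp_hom[OF as comp_hom[OF eb b]])
    show "(?H \<boxtimes> ?H) \<boxtimes> N \<in> Obj C" by (rule tobj_closed[OF HH N])
  qed
  moreover have "b \<bullet> (hunit H \<star> ?n) = lunit C N"
  proof (rule cancel)
    show "i \<bullet> (b \<bullet> (hunit H \<star> ?n)) = i \<bullet> lunit C N"
      using act[OF hunit_hom unit_closed] au lunit_natural[OF i] by simp
    show "b \<bullet> (hunit H \<star> ?n) \<in> Hom C (?I \<boxtimes> N) N"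
      by (rule comp_hom[OF tarr_hom[OF hunit_hom n] b])
  qed (use lu tobj_closed[OF unit_closed N] in auto)
  ultimately show ?thesis using N b by (simp add: hmodule_def)
qed

section \<open>The Hopf algebra on elements of its underlying vector space\<close>

locale braided_hopf_algebra_over = forgetful_functor C k F + braided_hopf_algebra C H
  for C :: "('o, 'm, 'x) braided_category_scheme" (structure)
    and k :: "('k, 'r) ring_scheme"
    and F :: "('o, 'm, 'k, 'v) vect_functor"
    and H :: "('o, 'm) hopf"
begin

abbreviation VH :: "('k, 'v) module" where "VH \<equiv> Fobj F (hobj H)"
abbreviation VI :: "('k, 'v) module" where "VI \<equiv> Fobj F (unitobj C)"
text \<open>The product \<open>h x\<close> of two elements of \<open>F(H)\<close>.\<close>

abbreviation act :: "'v \<Rightarrow> 'v \<Rightarrow> 'v" where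
  "act h x \<equiv> Farr F (hmult H) (ptensor F (hobj H) (hobj H) h x)"

lemma ptensor_closed:
  assumes "U \<in> Obj C" "V \<in> Obj C" "u \<in> carrier (Fobj F U)" "v \<in> carrier (Fobj F V)"
  shows "ptensor F U V u v \<in> carrier (Fobj F (U \<boxtimes> V))"
  using assms by (intro tensor_product_closed[OF ptensor])

lemma Farr_closed:
  "\<lbrakk>f \<in> Hom C U V; x \<in> carrier (Fobj F U)\<rbrakk> \<Longrightarrow> Farr F f x \<in> carrier (Fobj F V)"
  by (rule linear_maps_closed[OF Farr_linear])

lemma Farr_comp_apply:
  "\<lbrakk>f \<in> Hom C U V; g \<in> Hom C V W; x \<in> carrier (Fobj F U)\<rbrakk>
    \<Longrightarrow> Farr F (g \<bullet> f) x = Farr F g (Farr F f x)"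
  by (simp add: Farr_comp compose_def)

text \<open>The counit takes values in \<open>F(I)\<close>, while integrals are defined with scalars
  in \<open>k\<close>; bijectivity of \<open>scalar F\<close> allows passing between the
  two.\<close>

lemma counit_val_closed: "h \<in> carrier VH \<Longrightarrow> counit_val k F H h \<in> carrier k"
  and scalar_counit_val: "h \<in> carrier VH \<Longrightarrow> scalar F (counit_val k F H h) = Farr F (hcounit H) h"
  using scalar_bij Farr_closed[OF hcounit_hom, of h] unfolding counit_val_def bij_betw_def
  by (auto intro: the_inv_into_into f_the_inv_into_f)

text \<open>Multiplicativity of the counit on elements. The product on \<open>F(I)\<close> is the
  left unitor, which lies over scalar multiplication.\<close>

lemma counit_act:
  assumes "h \<in> carrier VH" "x \<in> carrier VH"
  shows "Farr F (hcounit H) (act h x) = counit_val k F H h \<odot>\<^bsub>VI\<^esub> Farr F (hcounit H) x"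
proof -
  let ?t = "ptensor F (hobj H) (hobj H) h x"
  have t: "?t \<in> carrier (Fobj F (hobj H \<boxtimes> hobj H))"
    using ptensor_closed hobj_closed assms by blast
  have lu: "lunit C (unitobj C) \<in> Hom C (unitobj C \<boxtimes> unitobj C) (unitobj C)"
    using lunit_iso[OF unit_closed] by (simp add: isos_def)
  have "Farr F (hcounit H) (act h x)
      = Farr F (lunit C (unitobj C)) (Farr F (hcounit H \<star> hcounit H) ?t)"
    using Farr_comp_apply[OF hmult_hom hcounit_hom t]
      Farr_comp_apply[OF tarr_hom[OF hcounit_hom hcounit_hom] lu t] hcounit_mult by simp
  \<comment> \<open>Only the left factor is rewritten as a value of \<open>scalar F\<close>, the
    form in which \<open>Farr_lunit\<close> evaluates the unitor.\<close>
  also have "Farr F (hcounit H \<star> hcounit H) ?t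
      = ptensor F (unitobj C) (unitobj C) (scalar F (counit_val k F H h)) (Farr F (hcounit H) x)"
    using Farr_tarr[OF hcounit_hom hcounit_hom assms] scalar_counit_val[OF assms(1)] by simp
  finally show ?thesis
    using Farr_lunit[OF unit_closed counit_val_closed[OF assms(1)] Farr_closed[OF hcounit_hom assms(2)]]
    by simp
qed

text \<open>The counit is multiplicative, so its kernel is a left ideal. The factorization property
  of the kernel turns this linear fact into an action that is an arrow of \<open>C\<close>.\<close>

lemma counit_kernel_hsubmodule:
  assumes "counit_kernel_in C F H"
  obtains K b i where "hsubmodule C F H (hobj H) (hmult H) K b i"
    and "subspace_of F K i = {x \<in> carrier VH. Farr F (hcounit H) x = \<zero>\<^bsub>VI\<^esub>}"
proof -
  let ?e = "ident C (hobj H)"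
  from assms obtain K i where sub: "subobject C F (hobj H) K i"
    and ker: "subspace_of F K i = {x \<in> carrier VH. Farr F (hcounit H) x = \<zero>\<^bsub>VI\<^esub>}"
    and fac: "\<And>X f. \<lbrakk>X \<in> Obj C; f \<in> Hom C X (hobj H);
        \<forall>x \<in> carrier (Fobj F X). Farr F (hcounit H \<bullet> f) x = \<zero>\<^bsub>VI\<^esub>\<rbrakk>
      \<Longrightarrow> \<exists>!g. g \<in> Hom C X K \<and> i \<bullet> g = f"
    unfolding counit_kernel_in_def by blast
  from sub have K: "K \<in> Obj C" and i: "i \<in> Hom C K (hobj H)" and mono: "mono_arr C i"
    by (auto simp: subobject_def)
  \<comment> \<open>Left multiplication restricted to the kernel, viewed with values in
    \<open>H\<close>. Its factorization through \<open>i\<close> will be the action on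
    \<open>K\<close>.\<close>
  let ?f = "hmult H \<bullet> (?e \<star> i)"
  note e = ident_hom[OF hobj_closed]
  note HK = tobj_closed[OF hobj_closed K]
  have ei: "?e \<star> i \<in> Hom C (hobj H \<boxtimes> K) (hobj H \<boxtimes> hobj H)" by (rule tarr_hom[OF e i])
  have f: "?f \<in> Hom C (hobj H \<boxtimes> K) (hobj H)" by (rule comp_hom[OF ei hmult_hom])
  have "Farr F (hcounit H \<bullet> ?f) (ptensor F (hobj H) K h x) = \<zero>\<^bsub>VI\<^esub>"
    if h: "h \<in> carrier VH" and x: "x \<in> carrier (Fobj F K)" for h x
  proof -
    interpret VI: module k VI by (rule Fobj_vector_space[OF unit_closed])
    have t: "ptensor F (hobj H) K h x \<in> carrier (Fobj F (hobj H \<boxtimes> K))"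
      by (rule ptensor_closed[OF hobj_closed K h x])
    have ix: "Farr F i x \<in> carrier VH" "Farr F (hcounit H) (Farr F i x) = \<zero>\<^bsub>VI\<^esub>"
      using ker x unfolding subspace_of_def by blast+
    have "Farr F (hcounit H \<bullet> ?f) (ptensor F (hobj H) K h x)
        = Farr F (hcounit H) (act h (Farr F i x))"
      using Farr_comp_apply[OF f hcounit_hom t] Farr_comp_apply[OF ei hmult_hom t]
        Farr_tarr[OF e i h x] h by (simp add: Farr_ident hobj_closed)
    then show ?thesis
      using counit_act[OF h ix(1)] ix(2) counit_val_closed[OF h] by simp
  qed
  \<comment> \<open>Vanishing is known on pure tensors only; linearity and
    \<open>tensor_product_zero\<close> extend it to all of \<open>F(H \<otimes> K)\<close>.\<close>
  then have "\<forall>x \<in> carrier (Fobj F (hobj H \<boxtimes> K)). Farr F (hcounit H \<bullet> ?f) x = \<zero>\<^bsub>VI\<^esub>"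
    using tensor_product_zero[OF ptensor[OF hobj_closed K] _ _ _ _ Farr_linear[OF comp_hom[OF f hcounit_hom]]]
    by (simp add: Fobj_vector_space hobj_closed K HK unit_closed)
  from fac[OF HK f this] obtain b where b: "b \<in> Hom C (hobj H \<boxtimes> K) K" "i \<bullet> b = ?f"
    by blast
  then have "hmodule C H K b"
    using hmodule_of_mono[OF regular_hmodule K i mono] by blast
  then have "hsubmodule C F H (hobj H) (hmult H) K b i"
    using sub b by (simp add: hsubmodule_def)
  then show thesis using ker that by blast
qed

text \<open>With \<open>y\<close> the image of \<open>l\<close>, both terms are images under
  \<open>j\<close>: the first because \<open>j\<close> commutes with the actions, the second because
  \<open>Farr F j\<close> is linear. The difference can therefore be formed in
  \<open>F(L)\<close>.\<close>

lemma hsubmodule_act_minus_closed: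
  assumes "hsubmodule C F H (hobj H) (hmult H) L c j" and h: "h \<in> carrier VH"
    and y: "y \<in> subspace_of F L j" and s: "s \<in> carrier k"
  shows "act h y \<ominus>\<^bsub>VH\<^esub> s \<odot>\<^bsub>VH\<^esub> y \<in> subspace_of F L j"
proof -
  from assms(1) have L: "L \<in> Obj C" and c: "c \<in> Hom C (hobj H \<boxtimes> L) L" and j: "j \<in> Hom C L (hobj H)"
    and jc: "j \<bullet> c = hmult H \<bullet> (ident C (hobj H) \<star> j)"
    by (auto simp: hsubmodule_def hmodule_def subobject_def)
  interpret VL: module k "Fobj F L" by (rule Fobj_vector_space[OF L])
  from y obtain l where l: "l \<in> carrier (Fobj F L)" and yl: "y = Farr F j l"
    by (auto simp: subspace_of_def)
  let ?t = "ptensor F (hobj H) L h l"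
  have t: "?t \<in> carrier (Fobj F (hobj H \<boxtimes> L))" by (rule ptensor_closed[OF hobj_closed L h l])
  have ct: "Farr F c ?t \<in> carrier (Fobj F L)" by (rule Farr_closed[OF c t])
  have sl: "s \<odot>\<^bsub>Fobj F L\<^esub> l \<in> carrier (Fobj F L)" using s l by simp
  note e = ident_hom[OF hobj_closed]
  have "act h y = Farr F j (Farr F c ?t)"
    using Farr_comp_apply[OF tarr_hom[OF e j] hmult_hom t] Farr_comp_apply[OF c j t]
      Farr_tarr[OF e j h l] h jc yl by (simp add: Farr_ident hobj_closed)
  moreover have "s \<odot>\<^bsub>VH\<^esub> y = Farr F j (s \<odot>\<^bsub>Fobj F L\<^esub> l)"
    using linear_maps_smult[OF Farr_linear[OF j] s l] yl by simp
  ultimately have "act h y \<ominus>\<^bsub>VH\<^esub> s \<odot>\<^bsub>VH\<^esub> y = Farr F j (Farr F c ?t \<ominus>\<^bsub>Fobj F L\<^esub> s \<odot>\<^bsub>Fobj F L\<^esub> l)"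
    using linear_maps_minus[OF Fobj_vector_space[OF L] Fobj_vector_space[OF hobj_closed]
        Farr_linear[OF j] ct sl] by simp
  then show ?thesis using ct sl by (simp add: subspace_of_def)
qed

text \<open>The integral comes out normalized, since its counit equals that of the unit element of
  \<open>H\<close>.\<close>

lemma integral_of_kernel_complement:
  assumes L: "hsubmodule C F H (hobj H) (hmult H) L c j"
    and sum: "direct_sum VH {x \<in> carrier VH. Farr F (hcounit H) x = \<zero>\<^bsub>VI\<^esub>} (subspace_of F L j)"
  obtains y where "y \<in> left_integrals k F H" "counit_val k F H y = \<one>\<^bsub>k\<^esub>"
proof -
  interpret VH: module k VH by (rule Fobj_vector_space[OF hobj_closed])
  interpret VI: module k VI by (rule Fobj_vector_space[OF unit_closed])
  have eps: "Farr F (hcounit H) \<in> linear_maps k VH VI" by (rule Farr_linear[OF hcounit_hom])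
  have s1: "scalar F \<one>\<^bsub>k\<^esub> \<in> carrier VI" using scalar_bij by (auto simp: bij_betw_def)
  \<comment> \<open>The unit element of the algebra \<open>F(H)\<close>, the image of the scalar 1
    under the unit arrow.\<close>
  define u where "u = Farr F (hunit H) (scalar F \<one>\<^bsub>k\<^esub>)"
  have u: "u \<in> carrier VH" unfolding u_def by (rule Farr_closed[OF hunit_hom s1])
  have eu: "Farr F (hcounit H) u = scalar F \<one>\<^bsub>k\<^esub>"
    unfolding u_def using Farr_comp_apply[OF hunit_hom hcounit_hom s1] s1
    by (simp add: hcounit_unit Farr_ident unit_closed)
  from u sum obtain x y where x: "x \<in> carrier VH" "Farr F (hcounit H) x = \<zero>\<^bsub>VI\<^esub>"
    and yL: "y \<in> subspace_of F L j" and uxy: "u = x \<oplus>\<^bsub>VH\<^esub> y"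
    unfolding direct_sum_def set_add_def' by blast
  from L yL have y: "y \<in> carrier VH"
    by (auto simp: hsubmodule_def subobject_def subspace_of_def intro: Farr_closed)
  have ey: "Farr F (hcounit H) y = scalar F \<one>\<^bsub>k\<^esub>"
    using eu linear_maps_add[OF eps x(1) y] x(2) Farr_closed[OF hcounit_hom y] uxy by simp
  have "act h y = counit_val k F H h \<odot>\<^bsub>VH\<^esub> y" if h: "h \<in> carrier VH" for h
  proof -
    let ?s = "counit_val k F H h" and ?z = "act h y \<ominus>\<^bsub>VH\<^esub> counit_val k F H h \<odot>\<^bsub>VH\<^esub> y"
    have s: "?s \<in> carrier k" by (rule counit_val_closed[OF h])
    have hy: "act h y \<in> carrier VH"
      by (rule Farr_closed[OF hmult_hom ptensor_closed[OF hobj_closed hobj_closed h y]])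
    have sy: "?s \<odot>\<^bsub>VH\<^esub> y \<in> carrier VH" using s y by simp
    \<comment> \<open>Both \<open>h y\<close> and \<open>\<epsilon>(h) y\<close> have counit
      \<open>\<epsilon>(h) \<epsilon>(y)\<close>, by \<open>counit_act\<close> and by linearity
      respectively.\<close>
    have "Farr F (hcounit H) ?z = \<zero>\<^bsub>VI\<^esub>"
      using linear_maps_minus[OF VH.module_axioms VI.module_axioms eps hy sy]
        counit_act[OF h y] linear_maps_smult[OF eps s y] s Farr_closed[OF hcounit_hom y]
      by (simp add: VI.M.minus_eq VI.M.r_neg)
    then have "?z \<in> {x \<in> carrier VH. Farr F (hcounit H) x = \<zero>\<^bsub>VI\<^esub>} \<inter> subspace_of F L j"
      using hy sy hsubmodule_act_minus_closed[OF L h yL s] by simp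
    then have "?z = \<zero>\<^bsub>VH\<^esub>" using sum by (auto simp: direct_sum_def)
    \<comment> \<open>A vanishing difference gives equality by uniqueness of additive inverses,
      applied to the negative of \<open>\<epsilon>(h) y\<close>.\<close>
    then show ?thesis
      using VH.M.minus_equality[of "act h y" "\<ominus>\<^bsub>VH\<^esub> (?s \<odot>\<^bsub>VH\<^esub> y)"] hy sy
      by (simp add: VH.M.minus_eq)
  qed
  then have "y \<in> left_integrals k F H" using y by (simp add: left_integrals_def)
  moreover have "counit_val k F H y = \<one>\<^bsub>k\<^esub>"
    using scalar_bij by (simp add: counit_val_def ey the_inv_into_f_f bij_betw_def)
  ultimately show thesis by (rule that)
qed

end

theorem theorem4p2:
  fixes k :: "('k, 'r) ring_scheme"
    and C :: "('o, 'm, 'x) braided_category_scheme"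
    and F :: "('o, 'm, 'k, 'v) vect_functor"
    and H :: "('o, 'm) hopf"
  assumes "field k"
    and "braided_tensor_category C"
    and "forgetful_functor C k F"
    and "braided_hopf_algebra C H"
    and "semisimple_wrt C F H"
    and "counit_kernel_in C F H"
  shows "counit_val k F H ` left_integrals k F H \<noteq> {\<zero>\<^bsub>k\<^esub>}"
proof -
  interpret braided_hopf_algebra_over C k F H
    using assms(3,4) by (rule braided_hopf_algebra_over.intro)
  obtain K b i where K: "hsubmodule C F H (hobj H) (hmult H) K b i"
    and ker: "subspace_of F K i = {x \<in> carrier VH. Farr F (hcounit H) x = \<zero>\<^bsub>VI\<^esub>}"
    by (rule counit_kernel_hsubmodule[OF assms(6)])
  obtain L c j where L: "hsubmodule C F H (hobj H) (hmult H) L c j"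
    and "direct_sum VH (subspace_of F K i) (subspace_of F L j)"
    using assms(5) regular_hmodule K unfolding semisimple_wrt_def by blast
  then obtain y where "y \<in> left_integrals k F H" "counit_val k F H y = \<one>\<^bsub>k\<^esub>"
    using integral_of_kernel_complement[OF L] ker by auto
  \<comment> \<open>The image of the integrals contains 1, which differs from 0 in a field, so it
    cannot be the zero set.\<close>
  then have "\<one>\<^bsub>k\<^esub> \<in> counit_val k F H ` left_integrals k F H" by force
  then show ?thesis using one_not_zero by blast
qed

end
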